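(* For every integer $n\ge1$, $$m(n)\ge C(n):=(n-1)!+n-2+\sum_{d\mid n}\bigl|\mathrm{cycles}^{(1)}(d)\bigr|.$$
   Context: Let $n\ge1$ and $[n]=\{1,\dots,n\}$. A permutation $\pi\in S_n$ is identified with its one-line word $\pi(1)\pi(2)\cdots\pi(n)$. Let $\sigma\in S_n$ be the cycle $\sigma(i)=i+1$ for $i<n$, $\sigma(n)=1$; values and positions are taken modulo $n$ with representatives in $[n]$. For $\pi\in S_n$ let $\mathrm{inc}(\pi)=\{\sigma^k\circ\pi: 0\le k\le n-1\}$, and let $\mathcal{R}_2$ be the equivalence relation $\pi\,\mathcal{R}_2\,\pi'\iff\pi'\in\mathrm{inc}(\pi)$; it has $(n-1)!$ classes. A word $u$ over $[n]$ is a universal word for $\mathcal{R}_2$ if for every $\pi\in S_n$ some contiguous factor $u(i)\cdots u(i+n-1)$ of $u$ equals the one-line word of some element of $\mathrm{inc}(\pi)$. $m(n)$ denotes the minimal length of a universal word for $\mathcal{R}_2$. The map $f(\mathrm{inc}(\pi))=\mathrm{inc}(\pi\circ\sigma)$ is a well-defined permutation of the set of $\mathcal{R}_2$-classes. A 1-cycle is an orbit of $f$ (a class fixed by $f$ is a 1-cycle of length 1). $\mathrm{cycles}^{(1)}(d)$ denotes the set of 1-cycles consisting of exactly $d$ classes. *)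

theory Defs
  imports
    "HOL-Combinatorics.Permutations"
    "HOL-Combinatorics.Orbits"
    "HOL-Library.Sublist"
begin

text \<open>A permutation of \<open>[n] = {1..n}\<close> is a function that permutes \<open>{1..n}\<close> in the sense of the
  library; in particular it is the identity outside \<open>{1..n}\<close>.\<close>

abbreviation perms :: "nat \<Rightarrow> (nat \<Rightarrow> nat) set" where
  "perms n \<equiv> {\<pi>. \<pi> permutes {1..n}}"

definition one_line :: "nat \<Rightarrow> (nat \<Rightarrow> nat) \<Rightarrow> nat list" where
  "one_line n \<pi> = map \<pi> [1..<Suc n]"

definition \<sigma> :: "nat \<Rightarrow> nat \<Rightarrow> nat" where
  "\<sigma> n i = (if i \<in> {1..n} then (if i < n then i + 1 else 1) else i)"

definition inc :: "nat \<Rightarrow> (nat \<Rightarrow> nat) \<Rightarrow> (nat \<Rightarrow> nat) set" where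
  "inc n \<pi> = {(\<sigma> n ^^ k) \<circ> \<pi> | k. k < n}"

definition R2 :: "nat \<Rightarrow> ((nat \<Rightarrow> nat) \<times> (nat \<Rightarrow> nat)) set" where
  "R2 n = {(\<pi>, \<pi>'). \<pi> \<in> perms n \<and> \<pi>' \<in> inc n \<pi>}"

definition classes :: "nat \<Rightarrow> (nat \<Rightarrow> nat) set set" where
  "classes n = perms n // R2 n"

definition universal_word :: "nat \<Rightarrow> nat list \<Rightarrow> bool" where
  "universal_word n u \<longleftrightarrow>
     set u \<subseteq> {1..n} \<and> (\<forall>\<pi>\<in>perms n. \<exists>\<rho>\<in>inc n \<pi>. sublist (one_line n \<rho>) u)"

definition min_universal_length :: "nat \<Rightarrow> nat" where
  "min_universal_length n = (LEAST l. \<exists>u. universal_word n u \<and> length u = l)"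

text \<open>The map \<open>inc \<pi> \<mapsto> inc (\<pi> \<circ> \<sigma>)\<close> on classes, defined by collecting the values over all
  representatives; independence of the representative is lemma \<open>class_map_inc\<close> below.\<close>

definition class_map :: "nat \<Rightarrow> (nat \<Rightarrow> nat) set \<Rightarrow> (nat \<Rightarrow> nat) set" where
  "class_map n c = (\<Union>\<pi>\<in>c. inc n (\<pi> \<circ> \<sigma> n))"

text \<open>The library's \<open>orbit f c\<close> starts at \<open>f c\<close>; it contains \<open>c\<close> here, as \<open>class_map n\<close> permutes
  the finite set of classes.\<close>

definition one_cycles :: "nat \<Rightarrow> nat \<Rightarrow> (nat \<Rightarrow> nat) set set set" where
  "one_cycles n d = {Z \<in> orbit (class_map n) ` classes n. card Z = d}"

text \<open>For \<open>n = 1\<close> the term \<open>n - 2\<close> is \<open>-1\<close>, hence the bound is an integer.\<close>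

definition C_bound :: "nat \<Rightarrow> int" where
  "C_bound n = fact (n - 1) + int n - 2 + (\<Sum>d | d dvd n. int (card (one_cycles n d)))"


lemma \<sigma>_funpow:
  "j < n \<Longrightarrow> (\<sigma> n ^^ k) (Suc j) = Suc ((j + k) mod n)"
proof (induction k)
  case (Suc k)
  then have "(j + k) mod n < n" by simp
  then show ?case
    using Suc.IH[OF Suc.prems] by (simp add: mod_Suc) (simp add: \<sigma>_def)
qed simp

lemma \<sigma>_outside: "i \<notin> {1..n} \<Longrightarrow> \<sigma> n i = i"
  unfolding \<sigma>_def by (rule if_not_P)

lemma \<sigma>_funpow_outside:
  assumes "i \<notin> {1..n}"
  shows "(\<sigma> n ^^ k) i = i"
  using \<sigma>_outside[OF assms] by (induction k) simp_all

lemma \<sigma>_funpow_mod: "\<sigma> n ^^ (k mod n) = \<sigma> n ^^ k"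
proof
  fix i
  show "(\<sigma> n ^^ (k mod n)) i = (\<sigma> n ^^ k) i"
  proof (cases "i \<in> {1..n}")
    case True
    then obtain j where "i = Suc j" "j < n" by (cases i) auto
    then show ?thesis by (simp only: \<sigma>_funpow mod_add_right_eq)
  next
    case False
    then show ?thesis by (simp only: \<sigma>_funpow_outside not_False_eq_True)
  qed
qed

lemma \<sigma>_permutes: "\<sigma> n permutes {1..n}"
proof (rule bij_imp_permutes)
  have "inj_on (\<sigma> n) {1..n}"
    by (auto simp: inj_on_def \<sigma>_def split: if_splits)
  moreover have "\<sigma> n ` {1..n} \<subseteq> {1..n}"
    by (auto simp: \<sigma>_def)
  ultimately show "bij_betw (\<sigma> n) {1..n} {1..n}"
    by (simp add: bij_betw_def endo_inj_surj)
qed (rule \<sigma>_outside)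

lemma \<sigma>_funpow_permutes: "(\<sigma> n ^^ k) permutes {1..n}"
proof (induction k)
  case (Suc k)
  then show ?case using permutes_compose[OF Suc \<sigma>_permutes] by (simp only: funpow.simps)
qed (simp only: funpow.simps permutes_id)

lemma inc_eq:
  assumes "n \<ge> 1"
  shows "inc n \<pi> = range (\<lambda>k. (\<sigma> n ^^ k) \<circ> \<pi>)"
proof -
  have "(\<sigma> n ^^ k) \<circ> \<pi> \<in> inc n \<pi>" for k
  proof -
    have "k mod n < n" using assms by simp
    then show ?thesis unfolding inc_def by (metis (mono_tags, lifting) \<sigma>_funpow_mod mem_Collect_eq)
  qed
  then show ?thesis by (auto simp: inc_def)
qed

lemma inc_funpow:
  assumes "n \<ge> 1"
  shows "inc n ((\<sigma> n ^^ k) \<circ> \<pi>) = inc n \<pi>"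
proof
  show "inc n ((\<sigma> n ^^ k) \<circ> \<pi>) \<subseteq> inc n \<pi>"
    using assms by (auto simp: inc_eq comp_assoc [symmetric] funpow_add [symmetric])
next
  have "(\<sigma> n ^^ j) \<circ> \<pi> = (\<sigma> n ^^ (j + (n * k - k))) \<circ> ((\<sigma> n ^^ k) \<circ> \<pi>)" for j
  proof -
    have "j + (n * k - k) + k = j + n * k" using assms by (cases n) simp_all
    then have "\<sigma> n ^^ (j + (n * k - k) + k) = \<sigma> n ^^ j"
      by (metis \<sigma>_funpow_mod mod_mult_self2)
    then show ?thesis by (simp add: comp_assoc [symmetric] funpow_add [symmetric])
  qed
  then show "inc n \<pi> \<subseteq> inc n ((\<sigma> n ^^ k) \<circ> \<pi>)"
    using assms unfolding inc_eq[OF assms] by blast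
qed

lemma inc_self: "n \<ge> 1 \<Longrightarrow> \<pi> \<in> inc n \<pi>"
  unfolding inc_def by (rule CollectI, rule exI[of _ 0]) simp

lemma inc_subset_perms: "\<pi> \<in> perms n \<Longrightarrow> inc n \<pi> \<subseteq> perms n"
  using permutes_compose[OF _ \<sigma>_funpow_permutes] by (fastforce simp: inc_def)

lemma equiv_R2:
  assumes "n \<ge> 1"
  shows "equiv (perms n) (R2 n)"
proof -
  have same: "inc n \<pi>' = inc n \<pi>" if h: "\<pi>' \<in> inc n \<pi>" for \<pi> \<pi>'
  proof -
    obtain k where "\<pi>' = (\<sigma> n ^^ k) \<circ> \<pi>" using h unfolding inc_def by blast
    then show ?thesis by (simp only: inc_funpow[OF assms])
  qed
  show ?thesis
  proof (rule equivI)
    show "R2 n \<subseteq> perms n \<times> perms n" using inc_subset_perms by (auto simp: R2_def)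
    show "refl_on (perms n) (R2 n)" using assms by (auto simp: refl_on_def R2_def inc_self)
    show "sym (R2 n)"
    proof (rule symI)
      fix \<pi> \<pi>' assume "(\<pi>, \<pi>') \<in> R2 n"
      then have *: "\<pi> \<in> perms n" "\<pi>' \<in> inc n \<pi>" by (auto simp: R2_def)
      then have "\<pi>' \<in> perms n" using inc_subset_perms by blast
      moreover have "\<pi> \<in> inc n \<pi>'" using same[OF *(2)] inc_self[OF assms] by blast
      ultimately show "(\<pi>', \<pi>) \<in> R2 n" by (simp add: R2_def)
    qed
    show "trans (R2 n)"
    proof (rule transI)
      fix \<pi> \<pi>' \<pi>'' assume a: "(\<pi>, \<pi>') \<in> R2 n" and b: "(\<pi>', \<pi>'') \<in> R2 n"
      from a have *: "\<pi> \<in> perms n" "\<pi>' \<in> inc n \<pi>" by (auto simp: R2_def)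
      from b have "\<pi>'' \<in> inc n \<pi>'" by (auto simp: R2_def)
      with * show "(\<pi>, \<pi>'') \<in> R2 n" using same[OF *(2)] by (simp add: R2_def)
    qed
  qed
qed

lemma classes_eq: "classes n = inc n ` perms n"
  unfolding classes_def quotient_def R2_def by auto

lemma class_map_inc:
  assumes "n \<ge> 1"
  shows "class_map n (inc n \<pi>) = inc n (\<pi> \<circ> \<sigma> n)"
proof -
  have "inc n (\<rho> \<circ> \<sigma> n) = inc n (\<pi> \<circ> \<sigma> n)" if h: "\<rho> \<in> inc n \<pi>" for \<rho>
  proof -
    obtain k where "\<rho> = (\<sigma> n ^^ k) \<circ> \<pi>" using h unfolding inc_def by blast
    then show ?thesis by (simp only: comp_assoc inc_funpow[OF assms])
  qed
  then show ?thesis using inc_self[OF assms, of \<pi>] unfolding class_map_def by blast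
qed

text \<open>Universal words exist, so the minimum in \<open>min_universal_length\<close> is attained.\<close>

lemma universal_word_exists:
  assumes "n \<ge> 1"
  shows "\<exists>u. universal_word n u"
proof -
  have "finite (perms n)" by (rule finite_permutations) simp
  then obtain ps where ps: "set ps = perms n" using finite_list by blast
  define u where "u = concat (map (one_line n) ps)"
  have "\<pi> x \<in> {1..n}" if "\<pi> \<in> perms n" "x \<in> {1..n}" for \<pi> x
    using that permutes_in_image[of \<pi> "{1..n}" x] by blast
  then have "set u \<subseteq> {1..n}" using ps by (fastforce simp: u_def one_line_def)
  moreover have "sublist (one_line n \<pi>) u" if "\<pi> \<in> perms n" for \<pi>
  proof -
    have "\<pi> \<in> set ps" using that ps by simp
    then obtain xs ys where "ps = xs @ \<pi> # ys" by (meson split_list)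
    then show ?thesis by (auto simp: u_def sublist_def)
  qed
  ultimately show ?thesis
    using inc_self[OF assms] unfolding universal_word_def by blast
qed

end

theory Submission
  imports Defs
begin

text \<open>
  Two consecutive windows of length \<open>n\<close> in a word that are both permutations belong to classes
  \<open>c\<close> and \<open>f c\<close>. Record for every class the first position at which it appears in a universal
  word, and for every 1-cycle the last of these first positions. The position right after it
  is not the first appearance of any class: that class would be in the same 1-cycle, all of whose
  classes have been seen already. So each 1-cycle wastes a position of its own (only one of
  them may lie just beyond the end of the word), and the number of positions is at least the number of
  classes plus the number of 1-cycles minus one.
\<close>

section \<open>Counting the classes\<close>

lemma card_inc:
  assumes "n \<ge> 1" "\<pi> permutes {1..n}"
  shows "card (inc n \<pi>) = n"
proof -
  have "inj_on (\<lambda>k. (\<sigma> n ^^ k) \<circ> \<pi>) {..<n}"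
  proof (rule inj_onI)
    fix j k assume j: "j \<in> {..<n}" and k: "k \<in> {..<n}"
      and eq: "(\<sigma> n ^^ j) \<circ> \<pi> = (\<sigma> n ^^ k) \<circ> \<pi>"
    \<comment> \<open>The powers are told apart at the value \<open>1\<close>, which the
      \<open>k\<close>-th power sends to \<open>Suc k\<close> for \<open>k < n\<close>.\<close>
    obtain x where "\<pi> x = 1" using permutes_surj[OF assms(2)] by (metis surjD)
    then have "(\<sigma> n ^^ j) (Suc 0) = (\<sigma> n ^^ k) (Suc 0)" using fun_cong[OF eq, of x] by simp
    then show "j = k" using j k by (simp add: \<sigma>_funpow)
  qed
  moreover have "inc n \<pi> = (\<lambda>k. (\<sigma> n ^^ k) \<circ> \<pi>) ` {..<n}" by (auto simp: inc_def)
  ultimately show ?thesis by (simp add: card_image)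
qed

lemma classes_eqI:
  assumes "n \<ge> 1" "c \<in> classes n" "d \<in> classes n" "\<pi> \<in> c" "\<pi> \<in> d"
  shows "c = d"
  using quotient_disj[OF equiv_R2] assms unfolding classes_def by blast

lemma Union_classes: "n \<ge> 1 \<Longrightarrow> \<Union> (classes n) = perms n"
  unfolding classes_def by (rule Union_quotient[OF equiv_R2])

lemma finite_classes: "finite (classes n)"
  by (simp add: classes_eq finite_permutations)

text \<open>The classes partition the \<open>n!\<close> permutations into blocks of size
  \<open>n\<close>.\<close>

lemma card_classes:
  assumes "n \<ge> 1"
  shows "card (classes n) = fact (n - 1)"
proof -
  have "n * card (classes n) = card (\<Union> (classes n))"
  proof (rule card_partition)
    show "finite (\<Union> (classes n))" using Union_classes[OF assms] by (simp add: finite_permutations)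
    show "card c = n" if "c \<in> classes n" for c
      using that card_inc[OF assms] by (auto simp: classes_eq)
    show "c \<inter> d = {}" if "c \<in> classes n" "d \<in> classes n" "c \<noteq> d" for c d
      using that classes_eqI[OF assms] by blast
  qed (rule finite_classes)
  also have "\<dots> = fact n" using Union_classes[OF assms] by (simp add: card_permutations)
  also have "\<dots> = n * fact (n - 1)" using assms by (simp add: fact_reduce)
  finally show ?thesis using assms by simp
qed

section \<open>1-cycles as orbits of the class map\<close>

lemma class_map_funpow_inc:
  assumes "n \<ge> 1"
  shows "(class_map n ^^ k) (inc n \<pi>) = inc n (\<pi> \<circ> (\<sigma> n ^^ k))"
proof (induction k)
  case (Suc k)
  have "(class_map n ^^ Suc k) (inc n \<pi>) = class_map n ((class_map n ^^ k) (inc n \<pi>))" by simp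
  also have "\<dots> = inc n ((\<pi> \<circ> (\<sigma> n ^^ k)) \<circ> \<sigma> n)" unfolding Suc.IH by (rule class_map_inc[OF assms])
  finally show ?case by (simp only: funpow_Suc_right comp_assoc)
qed simp

lemma class_map_funpow_classes:
  assumes "n \<ge> 1" "c \<in> classes n"
  shows "(class_map n ^^ k) c \<in> classes n"
  using assms permutes_compose[OF \<sigma>_funpow_permutes]
  by (auto simp: classes_eq class_map_funpow_inc)

lemma orbit_class_map_subset:
  assumes "n \<ge> 1" "c \<in> classes n"
  shows "orbit (class_map n) c \<subseteq> classes n"
  using class_map_funpow_classes[OF assms] by (auto simp: orbit_altdef)

lemma self_in_orbit_class_map:
  assumes "n \<ge> 1" "c \<in> classes n"
  shows "c \<in> orbit (class_map n) c"
proof -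
  \<comment> \<open>An orbit starts with the first iterate, so a positive exponent returning to
    \<open>c\<close> is required; \<open>n\<close> is one, since rotating a word of length
    \<open>n\<close> by \<open>n\<close> places restores it.\<close>
  have "\<sigma> n ^^ n = id" using \<sigma>_funpow_mod[of n n] by simp
  then have "(class_map n ^^ n) c = c"
    using assms by (auto simp: classes_eq class_map_funpow_inc)
  then show ?thesis
    using assms(1) unfolding orbit_altdef by (intro CollectI exI[of _ n]) simp
qed

text \<open>Since \<open>c\<close> lies in its own orbit, membership in orbits is symmetric, and
  with transitivity the orbits become blocks determined by any of their elements.\<close>

lemma orbit_class_map_eqI:
  assumes "n \<ge> 1" "c \<in> classes n" "d \<in> orbit (class_map n) c"
  shows "orbit (class_map n) d = orbit (class_map n) c"
  using orbit_swap[OF self_in_orbit_class_map[OF assms(1,2)] assms(3)] assms(3)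
  by (blast intro: orbit_trans)

section \<open>Windows of a word\<close>

lemma length_one_line [simp]: "length (one_line n \<pi>) = n"
  by (simp add: one_line_def)

lemma one_line_nth [simp]: "i < n \<Longrightarrow> one_line n \<pi> ! i = \<pi> (Suc i)"
  by (simp add: one_line_def del: upt_Suc)

lemma one_line_eqD:
  assumes "one_line n \<pi> = one_line n \<rho>" "\<pi> permutes {1..n}" "\<rho> permutes {1..n}"
  shows "\<pi> = \<rho>"
proof
  fix x show "\<pi> x = \<rho> x"
  proof (cases "x \<in> {1..n}")
    case True
    then have "one_line n \<pi> ! (x - 1) = \<pi> x" "one_line n \<rho> ! (x - 1) = \<rho> x" by auto
    then show ?thesis using assms(1) by simp
  next
    case False
    then show ?thesis using assms(2,3) by (simp add: permutes_not_in)
  qed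
qed

lemma sublist_iff_take_drop:
  "sublist v u \<longleftrightarrow> (\<exists>i. i + length v \<le> length u \<and> take (length v) (drop i u) = v)"
proof
  assume "sublist v u"
  then obtain xs ys where "u = xs @ v @ ys" by (auto simp: sublist_def)
  then show "\<exists>i. i + length v \<le> length u \<and> take (length v) (drop i u) = v"
    by (intro exI[of _ "length xs"]) simp
next
  assume "\<exists>i. i + length v \<le> length u \<and> take (length v) (drop i u) = v"
  then show "sublist v u"
    by (metis append_take_drop_id sublist_def)
qed

text \<open>The windows overlap in \<open>n - 1\<close> letters, which fixes \<open>\<rho> x\<close>
  for \<open>1 \<le> x < n\<close>. The letter entering on the right must then be the one that left
  on the left, \<open>\<pi> 1\<close>.\<close>

lemma consecutive_windows:
  assumes n: "n \<ge> 1" and len: "Suc i + n \<le> length u"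
    and \<pi>: "\<pi> permutes {1..n}" "take n (drop i u) = one_line n \<pi>"
    and \<rho>: "\<rho> permutes {1..n}" "take n (drop (Suc i) u) = one_line n \<rho>"
  shows "\<rho> = \<pi> \<circ> \<sigma> n"
proof -
  have u_\<pi>: "u ! (i + j) = \<pi> (Suc j)" if "j < n" for j
  proof -
    have "take n (drop i u) ! j = u ! (i + j)" using that len by simp
    then show ?thesis using \<pi>(2) that by simp
  qed
  have u_\<rho>: "u ! (Suc i + j) = \<rho> (Suc j)" if "j < n" for j
  proof -
    have "take n (drop (Suc i) u) ! j = u ! (Suc i + j)" using that len by simp
    then show ?thesis using \<rho>(2) that by simp
  qed
  have step: "\<rho> x = \<pi> (Suc x)" if "1 \<le> x" "x < n" for x
    using u_\<rho>[of "x - 1"] u_\<pi>[of x] that by simp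
  have \<sigma>_step: "\<sigma> n x = Suc x" if "1 \<le> x" "x < n" for x using that by (simp add: \<sigma>_def)
  have comp: "(\<pi> \<circ> \<sigma> n) permutes {1..n}" by (rule permutes_compose[OF \<sigma>_permutes \<pi>(1)])
  have eq: "\<rho> x = (\<pi> \<circ> \<sigma> n) x" if "x \<noteq> n" for x
  proof (cases "1 \<le> x \<and> x < n")
    case True then show ?thesis by (simp add: step \<sigma>_step)
  next
    case False
    then have "x \<notin> {1..n}" using that by auto
    then show ?thesis using permutes_not_in[OF \<rho>(1)] permutes_not_in[OF comp] by simp
  qed
  \<comment> \<open>injective functions that agree off \<open>n\<close> and have the same range agree at \<open>n\<close>\<close>
  moreover have "\<rho> n = (\<pi> \<circ> \<sigma> n) n"
  proof -
    obtain y where y: "(\<pi> \<circ> \<sigma> n) y = \<rho> n" using permutes_surj[OF comp] by (metis surjD)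
    have "y = n"
    proof (rule ccontr)
      assume "y \<noteq> n"
      then have "\<rho> y = \<rho> n" using eq y by simp
      then show False using permutes_inj[OF \<rho>(1)] \<open>y \<noteq> n\<close> by (auto dest: injD)
    qed
    then show ?thesis using y by simp
  qed
  ultimately show ?thesis by (metis ext)
qed

definition occurs_at :: "nat \<Rightarrow> nat list \<Rightarrow> nat \<Rightarrow> (nat \<Rightarrow> nat) set \<Rightarrow> bool" where
  "occurs_at n u i c \<longleftrightarrow> i + n \<le> length u \<and> (\<exists>\<pi>\<in>c. take n (drop i u) = one_line n \<pi>)"

text \<open>A window spells at most one permutation and distinct classes are disjoint. Hence first
  occurrences of different classes start at different positions.\<close>

lemma occurs_at_unique:
  assumes "n \<ge> 1" "c \<in> classes n" "d \<in> classes n" "occurs_at n u i c" "occurs_at n u i d"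
  shows "c = d"
proof -
  obtain \<pi> \<rho> where *: "\<pi> \<in> c" "\<rho> \<in> d" "one_line n \<pi> = one_line n \<rho>"
    using assms(4,5) by (auto simp: occurs_at_def)
  then have "\<pi> = \<rho>" using Union_classes[OF assms(1)] assms(2,3) by (blast intro: one_line_eqD)
  then show ?thesis using * classes_eqI[OF assms(1-3)] by blast
qed

text \<open>This is the link between adjacency in the word and 1-cycles: moving the window by one
  place cannot lead from one 1-cycle directly into another.\<close>

lemma occurs_at_Suc:
  assumes "n \<ge> 1" "c \<in> classes n" "d \<in> classes n" "occurs_at n u i c" "occurs_at n u (Suc i) d"
  shows "d = class_map n c"
proof -
  obtain \<pi> \<rho> where \<pi>: "\<pi> \<in> c" "take n (drop i u) = one_line n \<pi>"
    and \<rho>: "\<rho> \<in> d" "take n (drop (Suc i) u) = one_line n \<rho>" and len: "Suc i + n \<le> length u"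
    using assms(4,5) by (auto simp: occurs_at_def)
  have perm: "\<pi> permutes {1..n}" "\<rho> permutes {1..n}"
    using Union_classes[OF assms(1)] assms(2,3) \<pi>(1) \<rho>(1) by blast+
  have "\<rho> = \<pi> \<circ> \<sigma> n"
    by (rule consecutive_windows[OF assms(1) len perm(1) \<pi>(2) perm(2) \<rho>(2)])
  then have "\<rho> \<in> class_map n c"
    using \<pi>(1) inc_self[OF assms(1)] unfolding class_map_def by blast
  moreover have "class_map n c \<in> classes n"
    using class_map_funpow_classes[OF assms(1,2), of 1] by simp
  ultimately show ?thesis using classes_eqI[OF assms(1,3)] \<rho>(1) by blast
qed

lemma universal_word_occurs:
  assumes "universal_word n u" "c \<in> classes n"
  shows "\<exists>i. occurs_at n u i c"
proof -
  obtain \<pi> where "\<pi> \<in> perms n" "c = inc n \<pi>" using assms(2) by (auto simp: classes_eq)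
  then obtain \<rho> where "\<rho> \<in> c" "sublist (one_line n \<rho>) u"
    using assms(1) by (auto simp: universal_word_def)
  then show ?thesis by (auto simp: occurs_at_def sublist_iff_take_drop)
qed

section \<open>Counting first and wasted positions\<close>

lemma length_universal_word:
  assumes n: "n \<ge> 1" and u: "universal_word n u"
  shows "fact (n - 1) + card (orbit (class_map n) ` classes n) + n \<le> length u + 2"
proof -
  define first where "first c = (LEAST i. occurs_at n u i c)" for c
  define last_new where "last_new Z = Max (first ` Z)" for Z
  define cycles where "cycles = orbit (class_map n) ` classes n"
  have first: "occurs_at n u (first c) c" if "c \<in> classes n" for c
    unfolding first_def using universal_word_occurs[OF u that] by (rule LeastI_ex)
  have inj_first: "inj_on first (classes n)"
    using first occurs_at_unique[OF n] by (metis inj_onI)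
  have cycle_eq: "Z = orbit (class_map n) c" if "Z \<in> cycles" "c \<in> Z" for Z c
    using that orbit_class_map_eqI[OF n] by (auto simp: cycles_def)
  have cycle_sub: "Z \<subseteq> classes n" if "Z \<in> cycles" for Z
    using that orbit_class_map_subset[OF n] by (auto simp: cycles_def)
  have le_last_new: "first c \<le> last_new Z" if "Z \<in> cycles" "c \<in> Z" for Z c
    using that finite_subset[OF cycle_sub finite_classes] by (simp add: last_new_def)
  have last_new: "\<exists>c\<in>Z. last_new Z = first c" if Z: "Z \<in> cycles" for Z
  proof -
    have "Z \<noteq> {}" using Z self_in_orbit_class_map[OF n] by (auto simp: cycles_def)
    then have "last_new Z \<in> first ` Z"
      unfolding last_new_def using finite_subset[OF cycle_sub[OF Z] finite_classes]
      by (intro Max_in) auto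
    then show ?thesis by blast
  qed
  \<comment> \<open>Each maximum is attained at a class of its 1-cycle. Equal maxima give the same
    class because \<open>first\<close> is injective, and a class lies in only one 1-cycle.\<close>
  have inj_last_new: "inj_on last_new cycles"
  proof (rule inj_onI)
    fix Y Z assume Y: "Y \<in> cycles" and Z: "Z \<in> cycles" and eq: "last_new Y = last_new Z"
    obtain c d where "c \<in> Y" "d \<in> Z" "first c = first d"
      using last_new[OF Y] last_new[OF Z] eq by auto
    moreover from this have "c = d"
      using inj_first cycle_sub Y Z by (blast dest: inj_onD)
    ultimately show "Y = Z" by (metis cycle_eq Y Z)
  qed
  have wasted: "Suc (last_new Z) \<notin> first ` classes n" if Z: "Z \<in> cycles" for Z
  proof
    assume "Suc (last_new Z) \<in> first ` classes n"
    then obtain d where d: "d \<in> classes n" "first d = Suc (last_new Z)" by auto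
    obtain c where c: "c \<in> Z" "last_new Z = first c" using last_new[OF Z] by blast
    have "c \<in> classes n" using c(1) cycle_sub[OF Z] by blast
    then have "d = class_map n c"
      using occurs_at_Suc[OF n _ d(1)] first[of c] first[OF d(1)] c(2) d(2) by simp
    then have "d \<in> Z" using cycle_eq[OF Z c(1)] by (simp add: orbit.base)
    \<comment> \<open>\<open>first d\<close> would exceed the maximum of \<open>first\<close> over
      \<open>Z\<close>.\<close>
    then show False using le_last_new[OF Z] d(2) by fastforce
  qed
  have bound: "first c + n \<le> length u" if "c \<in> classes n" for c
    using first[OF that] by (simp add: occurs_at_def)
  have fin: "finite cycles" by (simp add: cycles_def finite_classes)
  \<comment> \<open>Some class has to occur in \<open>u\<close>, so \<open>u\<close> has at least
    \<open>n\<close> letters and the subtraction \<open>length u - n\<close> below is not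
    truncated.\<close>
  have "inc n id \<in> classes n" using permutes_id by (auto simp: classes_eq)
  from bound[OF this] have len: "n \<le> length u" by simp
  \<comment> \<open>Windows start at \<open>0\<close> up to \<open>length u - n\<close>; a wasted
    position may lie one further. This leaves room for \<open>length u - n + 2\<close>
    positions.\<close>
  have "first ` classes n \<union> (Suc \<circ> last_new) ` cycles \<subseteq> {..length u - n + 1}"
    using bound last_new cycle_sub by fastforce
  then have "card (first ` classes n \<union> (Suc \<circ> last_new) ` cycles) \<le> length u - n + 2"
    using card_mono[OF finite_atMost] by fastforce
  moreover have "card (first ` classes n \<union> (Suc \<circ> last_new) ` cycles)
    = card (first ` classes n) + card ((Suc \<circ> last_new) ` cycles)"
    using wasted by (intro card_Un_disjoint) (force simp: finite_classes fin image_iff)+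
  moreover have "card (first ` classes n) = fact (n - 1)"
    using card_image[OF inj_first] card_classes[OF n] by simp
  moreover have "card ((Suc \<circ> last_new) ` cycles) = card cycles"
    by (intro card_image comp_inj_on inj_last_new) simp
  ultimately show ?thesis using len unfolding cycles_def by linarith
qed

text \<open>The sets \<open>one_cycles n d\<close> are disjoint for different \<open>d\<close>, as
  they sort orbits by size. An upper bound on the sum is what is wanted, because it enters a lower
  bound with a plus sign.\<close>

lemma sum_card_one_cycles_le:
  assumes "n \<ge> 1"
  shows "(\<Sum>d | d dvd n. card (one_cycles n d)) \<le> card (orbit (class_map n) ` classes n)"
proof -
  have fin: "finite (orbit (class_map n) ` classes n)" by (simp add: finite_classes)
  have "(\<Sum>d | d dvd n. card (one_cycles n d)) = card (\<Union>d\<in>{d. d dvd n}. one_cycles n d)"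
    using assms fin by (intro card_UN_disjoint[symmetric]) (auto simp: one_cycles_def)
  also have "\<dots> \<le> card (orbit (class_map n) ` classes n)"
    using fin by (intro card_mono) (auto simp: one_cycles_def)
  finally show ?thesis .
qed

theorem theorem6:
  fixes n :: nat
  assumes "n \<ge> 1"
  shows "int (min_universal_length n) \<ge> C_bound n"
proof -
  have "\<exists>u. universal_word n u \<and> length u = min_universal_length n"
    unfolding min_universal_length_def
    using universal_word_exists[OF assms]
    by (intro LeastI_ex[of "\<lambda>l. \<exists>u. universal_word n u \<and> length u = l"]) blast
  then obtain u where u: "universal_word n u" "length u = min_universal_length n" by blast
  \<comment> \<open>Over the naturals the \<open>2\<close> stays on the right, as
    \<open>n - 2\<close> would be truncated for \<open>n = 1\<close>; it is subtracted only among
    the integers.\<close>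
  have "fact (n - 1) + (\<Sum>d | d dvd n. card (one_cycles n d)) + n \<le> min_universal_length n + 2"
    using length_universal_word[OF assms u(1)] sum_card_one_cycles_le[OF assms] u(2) by linarith
  then have "int (fact (n - 1) + (\<Sum>d | d dvd n. card (one_cycles n d)) + n)
      \<le> int (min_universal_length n + 2)"
    by (simp only: of_nat_le_iff)
  then show ?thesis unfolding C_bound_def by simp
qed

end
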